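(* Every fD.LG-derivation of a normal sequent $S$ can be transformed into an f.LG-derivation of the f.LG-sequent $\lfloor S\rfloor$.
   Context: **The focused calculus f.LG** (minimal focused Lambek-Grishin calculus of Moortgat and Moot, with axioms on atoms only). Formulas are built from positive atoms $p$ and negative atoms $n$ by the binary connectives $\otimes,\oslash,\ominus,\oplus,\backslash,/$. A formula is positive if it is a positive atom or has main connective $\otimes,\oslash,\ominus$, and negative otherwise. Input structures $X ::= A\mid X\hat\otimes X\mid X\hat\oslash\Delta\mid\Delta\hat\ominus X$; output structures $\Delta ::= A\mid\Delta\check\oplus\Delta\mid X\check\backslash\Delta\mid\Delta\check/X$ ($A$ any formula). Sequents: neutral $X\vdash\Delta$, right-focused $X\vdash[A]$, left-focused $[A]\vdash\Delta$. Rules: axioms $p\vdash[p]$ and $[n]\vdash n$; focusing/defocusing: $X\vdash[A]\Rightarrow X\vdash A$ and $A\vdash\Delta\Rightarrow[A]\vdash\Delta$ for $A$ positive, $[A]\vdash\Delta\Rightarrow A\vdash\Delta$ and $X\vdash A\Rightarrow X\vdash[A]$ for $A$ negative; neutral display postulates $Y\vdash X\check\backslash\Delta\Leftrightarrow X\hat\otimes Y\vdash\Delta\Leftrightarrow X\vdash\Delta\check/Y$ and $X\hat\oslash\Delta\vdash\Gamma\Leftrightarrow X\vdash\Gamma\check\oplus\Delta\Leftrightarrow\Gamma\hat\ominus X\vdash\Delta$; translation rules replacing (in neutral sequents) $A\hat\star B$ by $A\star B$ on the left for $\star\in\{\otimes,\oslash,\ominus\}$ and $A\check\star B$ by $A\star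 B$ on the right for $\star\in\{\oplus,\backslash,/\}$ ($A,B$ formulas, standing alone on that side); tonicity rules: $X\vdash[A],Y\vdash[B]\Rightarrow X\hat\otimes Y\vdash[A\otimes B]$; $[A]\vdash\Gamma,[B]\vdash\Delta\Rightarrow[A\oplus B]\vdash\Gamma\check\oplus\Delta$; from $X\vdash[A]$ and $[B]\vdash\Delta$ infer each of $X\hat\oslash\Delta\vdash[A\oslash B]$, $\Delta\hat\ominus X\vdash[B\ominus A]$, $[A\backslash B]\vdash X\check\backslash\Delta$, $[B/A]\vdash\Delta\check/X$. **Normal sequents.** For an f.LG-formula define a positive fD.LG-formula $A^+$ and a negative one $A^-$ by: $p^+=p$, $(A\otimes B)^+=A^+\otimes B^+$, $(A\oslash B)^+=A^+\oslash B^-$, $(A\ominus B)^+=A^-\ominus B^+$, $n^-=n$, $(A\oplus B)^-=A^-\oplus B^-$, $(A\backslash B)^-=A^+\backslash B^-$, $(A/B)^-=A^-/B^+$; $A^-=\ \uparrow(A^+)$ if $A$ is positive and $A^+=\ \downarrow(A^-)$ if $A$ is negative. An input structure $X$ is sent to the positive structure $X^+$ (replace each formula $A$ in input position by $A^+$ and each formula in output position by $A^-$, keeping structural connectives), an output structure $\Delta$ to the negative structure $\Delta^-$ likewise. Then $\lceil X\vdash[A]\rceil=X^+\vdash_+A^+$, $\lceil[A]\vdash\Delta\rceil=A^-\vdash_-\Delta^-$, $\lceil X\vdash\Delta\rceil=X^+\vdash_0\Delta^-$. An fD.LG-sequent $S$ is normal if $S=\lceil S'\rceil$ for some f.LG-sequent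 $S'$. **Translation $\lfloor\cdot\rfloor$.** For an fD.LG-formula $A$, $\lfloor A\rfloor$ is the f.LG-formula obtained by removing all shifts; for a structure without structural shifts or $\ell,r$-variants, $\lfloor\Psi\rfloor$ is obtained by applying this to each formula in $\Psi$. For normal sequents: $\lfloor\mathring X\vdash_+\mathring P\rfloor=\lfloor\mathring X\rfloor\vdash[\lfloor\mathring P\rfloor]$, $\lfloor\mathring N\vdash_-\mathring\Delta\rfloor=[\lfloor\mathring N\rfloor]\vdash\lfloor\mathring\Delta\rfloor$, $\lfloor\mathring X\vdash_0\mathring\Delta\rfloor=\lfloor\mathring X\rfloor\vdash\lfloor\mathring\Delta\rfloor$. **The calculus fD.LG.** Over the same disjoint countably infinite sets of positive atoms $p$ and negative atoms $n$. Formulas of four sorts: pure positive $P ::= p\mid \mathring P\otimes\mathring P\mid \mathring P\oslash\mathring N\mid \mathring N\ominus\mathring P$; pure negative $N ::= n\mid \mathring N\oplus\mathring N\mid \mathring P\backslash\mathring N\mid \mathring N/\mathring P$; shifted positive $\dot P ::= \,\downarrow N$; shifted negative $\dot N ::= \,\uparrow P$. A ring means "pure or shifted": $\mathring P$ (general positive) is $P$ or $\dot P$, $\mathring N$ (general negative) is $N$ or $\dot N$; same convention for structures and for $Q,M,\dots$ Structures (structural connectives carry $\hat{\ }$ or $\check{\ }$): pure positive $X ::= P\mid \check{\Downarrow}\dot\Delta\mid \mathring X\hat\otimes\mathring X\mid\mathring X\hat\oslash\mathring\Delta\mid\mathring\Delta\hat\ominus\mathring X$; pure negative $\Delta ::=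 N\mid\hat{\Uparrow}\dot X\mid\mathring\Delta\check\oplus\mathring\Delta\mid\mathring X\check\backslash\mathring\Delta\mid\mathring\Delta\check/\mathring X$; shifted positive $\dot X ::= \dot P\mid\check\downarrow\Delta\mid\mathring X\check\oplus_\ell\mathring\Delta\mid\mathring\Delta\check\oplus_r\mathring X\mid\mathring\Delta\check\backslash_\ell\mathring\Delta\mid\mathring X\check\backslash_r\mathring X\mid\mathring X\check/_\ell\mathring X\mid\mathring\Delta\check/_r\mathring\Delta$; shifted negative $\dot\Delta ::= \dot N\mid\hat\uparrow X\mid\mathring\Delta\hat\otimes_\ell\mathring X\mid\mathring X\hat\otimes_r\mathring\Delta\mid\mathring\Delta\hat\oslash_\ell\mathring\Delta\mid\mathring X\hat\oslash_r\mathring X\mid\mathring X\hat\ominus_\ell\mathring X\mid\mathring\Delta\hat\ominus_r\mathring\Delta$. The connectives with subscript $\ell$ or $r$ are the $\ell,r$-variants. Sequents: positive $\mathring X\vdash_+\mathring Y$, negative $\mathring\Gamma\vdash_-\mathring\Delta$, neutral $\mathring X\vdash_0\mathring\Delta$ (the exact turnstile is determined by the sorts of both sides). Rules ($\Rightarrow$: premises to conclusion; $\Leftrightarrow$: both directions). *Axioms:* $p\vdash_+p$; $n\vdash_-n$. *Cuts:* $\mathring X\vdash_+\mathring P,\ \mathring P\vdash_+\mathring Y\Rightarrow\mathring X\vdash_+\mathring Y$; $\mathring\Gamma\vdash_-\mathring N,\ \mathring N\vdash_-\mathring\Delta\Rightarrow\mathring\Gamma\vdash_-\mathring\Delta$;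 $\mathring X\vdash_+\mathring P,\ \mathring P\vdash_0\mathring\Delta\Rightarrow\mathring X\vdash_0\mathring\Delta$; $\mathring X\vdash_0\mathring N,\ \mathring N\vdash_-\mathring\Delta\Rightarrow\mathring X\vdash_0\mathring\Delta$. *Translation rules:* $\mathring P\hat\otimes\mathring Q\vdash_0\mathring\Delta\Rightarrow\mathring P\otimes\mathring Q\vdash_0\mathring\Delta$; $\mathring P\hat\oslash\mathring N\vdash_0\mathring\Delta\Rightarrow\mathring P\oslash\mathring N\vdash_0\mathring\Delta$; $\mathring N\hat\ominus\mathring P\vdash_0\mathring\Delta\Rightarrow\mathring N\ominus\mathring P\vdash_0\mathring\Delta$; $\mathring X\vdash_0\mathring N\check\oplus\mathring M\Rightarrow\mathring X\vdash_0\mathring N\oplus\mathring M$; $\mathring X\vdash_0\mathring P\check\backslash\mathring N\Rightarrow\mathring X\vdash_0\mathring P\backslash\mathring N$; $\mathring X\vdash_0\mathring N\check/\mathring P\Rightarrow\mathring X\vdash_0\mathring N/\mathring P$; $\mathring X\vdash_+\check\downarrow N\Rightarrow\mathring X\vdash_+\downarrow N$; $\hat\uparrow P\vdash_-\mathring\Delta\Rightarrow\ \uparrow P\vdash_-\mathring\Delta$. *Tonicity rules:* $\mathring X\vdash_+\mathring P,\ \mathring Y\vdash_+\mathring Q\Rightarrow\mathring X\hat\otimes\mathring Y\vdash_+\mathring P\otimes\mathring Q$; $\mathring N\vdash_-\mathring\Gamma,\ \mathring M\vdash_-\mathring\Delta\Rightarrow\mathring N\oplus\mathring M\vdash_-\mathring\Gamma\check\oplus\mathring\Delta$;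 from $\mathring X\vdash_+\mathring P$ and $\mathring N\vdash_-\mathring\Delta$ infer each of $\mathring X\hat\oslash\mathring\Delta\vdash_+\mathring P\oslash\mathring N$, $\ \mathring\Delta\hat\ominus\mathring X\vdash_+\mathring N\ominus\mathring P$, $\ \mathring P\backslash\mathring N\vdash_-\mathring X\check\backslash\mathring\Delta$, $\ \mathring N/\mathring P\vdash_-\mathring\Delta\check/\mathring X$; $N\vdash_-\Delta\Rightarrow\ \downarrow N\vdash_+\check\downarrow\Delta$; $X\vdash_+P\Rightarrow\hat\uparrow X\vdash_-\uparrow P$. *Display postulates:* $\mathring Y\vdash_0\mathring X\check\backslash\mathring\Delta\Leftrightarrow\mathring X\hat\otimes\mathring Y\vdash_0\mathring\Delta\Leftrightarrow\mathring X\vdash_0\mathring\Delta\check/\mathring Y$; $\mathring X\hat\oslash\mathring\Delta\vdash_0\mathring\Gamma\Leftrightarrow\mathring X\vdash_0\mathring\Gamma\check\oplus\mathring\Delta\Leftrightarrow\mathring\Gamma\hat\ominus\mathring X\vdash_0\mathring\Delta$; $\mathring Y\vdash_+\mathring X\check\backslash_r\mathring Z\Leftrightarrow\mathring X\hat\otimes\mathring Y\vdash_+\mathring Z\Leftrightarrow\mathring X\vdash_+\mathring Z\check/_\ell\mathring Y$; $\mathring\Sigma\hat\oslash_\ell\mathring\Delta\vdash_-\mathring\Gamma\Leftrightarrow\mathring\Sigma\vdash_-\mathring\Gamma\check\oplus\mathring\Delta\Leftrightarrow\mathring\Gamma\hat\ominus_r\mathring\Sigma\vdash_-\mathring\Delta$;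 $\mathring\Gamma\hat\ominus\mathring X\vdash_+\mathring Y\Leftrightarrow\mathring X\vdash_+\mathring\Gamma\check\oplus_r\mathring Y\Leftrightarrow\mathring X\hat\oslash_r\mathring Y\vdash_-\mathring\Gamma$; $\mathring X\hat\oslash\mathring\Delta\vdash_+\mathring Y\Leftrightarrow\mathring X\vdash_+\mathring Y\check\oplus_\ell\mathring\Delta\Leftrightarrow\mathring Y\hat\ominus_\ell\mathring X\vdash_-\mathring\Delta$; $\mathring\Gamma\vdash_-\mathring X\check\backslash\mathring\Delta\Leftrightarrow\mathring X\hat\otimes_r\mathring\Gamma\vdash_-\mathring\Delta\Leftrightarrow\mathring X\vdash_+\mathring\Delta\check/_r\mathring\Gamma$; $\mathring Y\vdash_+\mathring\Gamma\check\backslash_\ell\mathring\Delta\Leftrightarrow\mathring\Gamma\hat\otimes_\ell\mathring Y\vdash_-\mathring\Delta\Leftrightarrow\mathring\Gamma\vdash_-\mathring\Delta\check/\mathring Y$; $\hat\uparrow X\vdash_-\dot\Delta\Leftrightarrow X\vdash_+\check\Downarrow\dot\Delta$; $\hat\uparrow X\vdash_-\Delta\Leftrightarrow X\vdash_+\check\downarrow\Delta$; $\dot X\vdash_+\check\downarrow\Delta\Leftrightarrow\hat\Uparrow\dot X\vdash_-\Delta$. *Structural rules:* $\mathring X\vdash_0\Delta\Leftrightarrow\mathring X\vdash_+\check\downarrow\Delta$; $X\vdash_0\mathring\Delta\Leftrightarrow\hat\uparrow X\vdash_-\mathring\Delta$. *)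

theory Defs
  imports Main
begin

section \<open>The focused calculus f.LG\<close>

text \<open>Both countably infinite sets of atoms are indexed by natural numbers.\<close>

datatype fm =
    FPAtom nat
  | FNAtom nat
  | FTensor fm fm
  | FOslash fm fm
  | FOminus fm fm
  | FOplus fm fm
  | FUnder fm fm  \<comment> \<open>\<open>FUnder A B\<close> is $A\backslash B$\<close>
  | FOver fm fm   \<comment> \<open>\<open>FOver A B\<close> is $A/B$\<close>

fun positive :: "fm \<Rightarrow> bool" where
  "positive (FPAtom p) = True"
| "positive (FTensor A B) = True"
| "positive (FOslash A B) = True"
| "positive (FOminus A B) = True"
| "positive _ = False"

abbreviation negative :: "fm \<Rightarrow> bool" where
  "negative A \<equiv> \<not> positive A"

datatype istr =
    IFm fm
  | ITensor istr istr
  | IOslash istr ostr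
  | IOminus ostr istr
and ostr =
    OFm fm
  | OOplus ostr ostr
  | OUnder istr ostr
  | OOver ostr istr

text \<open>\<open>X \<turnstile> D\<close> is neutral, \<open>RFocus X A\<close> is $X\vdash[A]$ and \<open>LFocus A D\<close> is $[A]\vdash\Delta$.\<close>

datatype fseq =
    Neutral istr ostr (infix "\<turnstile>" 50)
  | RFocus istr fm
  | LFocus fm ostr

inductive fLG :: "fseq \<Rightarrow> bool" where
  f_ax_pos: "fLG (RFocus (IFm (FPAtom p)) (FPAtom p))"
| f_ax_neg: "fLG (LFocus (FNAtom n) (OFm (FNAtom n)))"
| f_defoc_right: "positive A \<Longrightarrow> fLG (RFocus X A) \<Longrightarrow> fLG (X \<turnstile> OFm A)"
| f_foc_left: "positive A \<Longrightarrow> fLG (IFm A \<turnstile> D) \<Longrightarrow> fLG (LFocus A D)"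
| f_defoc_left: "negative A \<Longrightarrow> fLG (LFocus A D) \<Longrightarrow> fLG (IFm A \<turnstile> D)"
| f_foc_right: "negative A \<Longrightarrow> fLG (X \<turnstile> OFm A) \<Longrightarrow> fLG (RFocus X A)"
| f_dp_tensor_1: "fLG (Y \<turnstile> OUnder X D) \<Longrightarrow> fLG (ITensor X Y \<turnstile> D)"
| f_dp_tensor_2: "fLG (ITensor X Y \<turnstile> D) \<Longrightarrow> fLG (Y \<turnstile> OUnder X D)"
| f_dp_tensor_3: "fLG (ITensor X Y \<turnstile> D) \<Longrightarrow> fLG (X \<turnstile> OOver D Y)"
| f_dp_tensor_4: "fLG (X \<turnstile> OOver D Y) \<Longrightarrow> fLG (ITensor X Y \<turnstile> D)"
| f_dp_oplus_1: "fLG (IOslash X D \<turnstile> G) \<Longrightarrow> fLG (X \<turnstile> OOplus G D)"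
| f_dp_oplus_2: "fLG (X \<turnstile> OOplus G D) \<Longrightarrow> fLG (IOslash X D \<turnstile> G)"
| f_dp_oplus_3: "fLG (X \<turnstile> OOplus G D) \<Longrightarrow> fLG (IOminus G X \<turnstile> D)"
| f_dp_oplus_4: "fLG (IOminus G X \<turnstile> D) \<Longrightarrow> fLG (X \<turnstile> OOplus G D)"
| f_tr_tensor: "fLG (ITensor (IFm A) (IFm B) \<turnstile> D) \<Longrightarrow> fLG (IFm (FTensor A B) \<turnstile> D)"
| f_tr_oslash: "fLG (IOslash (IFm A) (OFm B) \<turnstile> D) \<Longrightarrow> fLG (IFm (FOslash A B) \<turnstile> D)"
| f_tr_ominus: "fLG (IOminus (OFm A) (IFm B) \<turnstile> D) \<Longrightarrow> fLG (IFm (FOminus A B) \<turnstile> D)"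
| f_tr_oplus: "fLG (X \<turnstile> OOplus (OFm A) (OFm B)) \<Longrightarrow> fLG (X \<turnstile> OFm (FOplus A B))"
| f_tr_under: "fLG (X \<turnstile> OUnder (IFm A) (OFm B)) \<Longrightarrow> fLG (X \<turnstile> OFm (FUnder A B))"
| f_tr_over: "fLG (X \<turnstile> OOver (OFm A) (IFm B)) \<Longrightarrow> fLG (X \<turnstile> OFm (FOver A B))"
| f_ton_tensor: "fLG (RFocus X A) \<Longrightarrow> fLG (RFocus Y B) \<Longrightarrow> fLG (RFocus (ITensor X Y) (FTensor A B))"
| f_ton_oplus: "fLG (LFocus A G) \<Longrightarrow> fLG (LFocus B D) \<Longrightarrow> fLG (LFocus (FOplus A B) (OOplus G D))"
| f_ton_oslash: "fLG (RFocus X A) \<Longrightarrow> fLG (LFocus B D) \<Longrightarrow> fLG (RFocus (IOslash X D) (FOslash A B))"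
| f_ton_ominus: "fLG (RFocus X A) \<Longrightarrow> fLG (LFocus B D) \<Longrightarrow> fLG (RFocus (IOminus D X) (FOminus B A))"
| f_ton_under: "fLG (RFocus X A) \<Longrightarrow> fLG (LFocus B D) \<Longrightarrow> fLG (LFocus (FUnder A B) (OUnder X D))"
| f_ton_over: "fLG (RFocus X A) \<Longrightarrow> fLG (LFocus B D) \<Longrightarrow> fLG (LFocus (FOver B A) (OOver D X))"


section \<open>The calculus fD.LG\<close>

text \<open>
  Pure positive, pure negative, shifted positive and shifted negative formulas; \<open>gpos\<close> and \<open>gneg\<close>
  are the general (ringed) sorts, i.e. the disjoint unions of the pure and the shifted sort.
\<close>

datatype ppos =
    PAtom nat
  | PTensor gpos gpos
  | POslash gpos gneg
  | POminus gneg gpos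
and pneg =
    NAtom nat
  | NOplus gneg gneg
  | NUnder gpos gneg
  | NOver gneg gpos
and spos = Down pneg
and sneg = Up ppos
and gpos = PPure ppos | PShift spos
and gneg = NPure pneg | NShift sneg

text \<open>
  Structures, again with the general sorts \<open>gposS\<close> and \<open>gnegS\<close>. \<open>XDDown\<close> and \<open>DUUp\<close> are the double
  arrows $\check\Downarrow$ and $\hat\Uparrow$, \<open>SXDown\<close> and \<open>SDUp\<close> the single arrows
  $\check\downarrow$ and $\hat\uparrow$; a final \<open>L\<close> or \<open>R\<close> marks the $\ell$- and $r$-variants.
\<close>

datatype pposS =
    XFm ppos
  | XDDown snegS
  | XTensor gposS gposS
  | XOslash gposS gnegS
  | XOminus gnegS gposS
and pnegS =
    DFm pneg
  | DUUp sposS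
  | DOplus gnegS gnegS
  | DUnder gposS gnegS
  | DOver gnegS gposS
and sposS =
    SXFm spos
  | SXDown pnegS
  | SXOplusL gposS gnegS
  | SXOplusR gnegS gposS
  | SXUnderL gnegS gnegS
  | SXUnderR gposS gposS
  | SXOverL gposS gposS
  | SXOverR gnegS gnegS
and snegS =
    SDFm sneg
  | SDUp pposS
  | SDTensorL gnegS gposS
  | SDTensorR gposS gnegS
  | SDOslashL gnegS gnegS
  | SDOslashR gposS gposS
  | SDOminusL gposS gposS
  | SDOminusR gnegS gnegS
and gposS = XPure pposS | XShift sposS
and gnegS = DPure pnegS | DShift snegS

fun posS :: "gpos \<Rightarrow> gposS" where
  "posS (PPure P) = XPure (XFm P)"
| "posS (PShift P) = XShift (SXFm P)"

fun negS :: "gneg \<Rightarrow> gnegS" where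
  "negS (NPure N) = DPure (DFm N)"
| "negS (NShift N) = DShift (SDFm N)"

datatype fdseq =
    SeqPos gposS gposS (infix "\<turnstile>\<^sub>+" 50)
  | SeqNeg gnegS gnegS (infix "\<turnstile>\<^sub>-" 50)
  | SeqNeu gposS gnegS (infix "\<turnstile>\<^sub>0" 50)

text \<open>
  In the rules, the sort of a metavariable is determined by its context: it is general unless it
  is an argument of a constructor taking a pure or a shifted argument.
\<close>

inductive fDLG :: "fdseq \<Rightarrow> bool" where
  ax_pos: "fDLG (XPure (XFm (PAtom p)) \<turnstile>\<^sub>+ XPure (XFm (PAtom p)))"
| ax_neg: "fDLG (DPure (DFm (NAtom n)) \<turnstile>\<^sub>- DPure (DFm (NAtom n)))"
| cut_pos: "fDLG (X \<turnstile>\<^sub>+ posS P) \<Longrightarrow> fDLG (posS P \<turnstile>\<^sub>+ Y) \<Longrightarrow> fDLG (X \<turnstile>\<^sub>+ Y)"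
| cut_neg: "fDLG (G \<turnstile>\<^sub>- negS N) \<Longrightarrow> fDLG (negS N \<turnstile>\<^sub>- D) \<Longrightarrow> fDLG (G \<turnstile>\<^sub>- D)"
| cut_neu_pos: "fDLG (X \<turnstile>\<^sub>+ posS P) \<Longrightarrow> fDLG (posS P \<turnstile>\<^sub>0 D) \<Longrightarrow> fDLG (X \<turnstile>\<^sub>0 D)"
| cut_neu_neg: "fDLG (X \<turnstile>\<^sub>0 negS N) \<Longrightarrow> fDLG (negS N \<turnstile>\<^sub>- D) \<Longrightarrow> fDLG (X \<turnstile>\<^sub>0 D)"
| tr_tensor: "fDLG (XPure (XTensor (posS P) (posS Q)) \<turnstile>\<^sub>0 D) \<Longrightarrow> fDLG (XPure (XFm (PTensor P Q)) \<turnstile>\<^sub>0 D)"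
| tr_oslash: "fDLG (XPure (XOslash (posS P) (negS N)) \<turnstile>\<^sub>0 D) \<Longrightarrow> fDLG (XPure (XFm (POslash P N)) \<turnstile>\<^sub>0 D)"
| tr_ominus: "fDLG (XPure (XOminus (negS N) (posS P)) \<turnstile>\<^sub>0 D) \<Longrightarrow> fDLG (XPure (XFm (POminus N P)) \<turnstile>\<^sub>0 D)"
| tr_oplus: "fDLG (X \<turnstile>\<^sub>0 DPure (DOplus (negS N) (negS M))) \<Longrightarrow> fDLG (X \<turnstile>\<^sub>0 DPure (DFm (NOplus N M)))"
| tr_under: "fDLG (X \<turnstile>\<^sub>0 DPure (DUnder (posS P) (negS N))) \<Longrightarrow> fDLG (X \<turnstile>\<^sub>0 DPure (DFm (NUnder P N)))"
| tr_over: "fDLG (X \<turnstile>\<^sub>0 DPure (DOver (negS N) (posS P))) \<Longrightarrow> fDLG (X \<turnstile>\<^sub>0 DPure (DFm (NOver N P)))"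
| tr_down: "fDLG (X \<turnstile>\<^sub>+ XShift (SXDown (DFm N))) \<Longrightarrow> fDLG (X \<turnstile>\<^sub>+ XShift (SXFm (Down N)))"
| tr_up: "fDLG (DShift (SDUp (XFm P)) \<turnstile>\<^sub>- D) \<Longrightarrow> fDLG (DShift (SDFm (Up P)) \<turnstile>\<^sub>- D)"
| ton_tensor: "fDLG (X \<turnstile>\<^sub>+ posS P) \<Longrightarrow> fDLG (Y \<turnstile>\<^sub>+ posS Q) \<Longrightarrow> fDLG (XPure (XTensor X Y) \<turnstile>\<^sub>+ XPure (XFm (PTensor P Q)))"
| ton_oplus: "fDLG (negS N \<turnstile>\<^sub>- G) \<Longrightarrow> fDLG (negS M \<turnstile>\<^sub>- D) \<Longrightarrow> fDLG (DPure (DFm (NOplus N M)) \<turnstile>\<^sub>- DPure (DOplus G D))"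
| ton_oslash: "fDLG (X \<turnstile>\<^sub>+ posS P) \<Longrightarrow> fDLG (negS N \<turnstile>\<^sub>- D) \<Longrightarrow> fDLG (XPure (XOslash X D) \<turnstile>\<^sub>+ XPure (XFm (POslash P N)))"
| ton_ominus: "fDLG (X \<turnstile>\<^sub>+ posS P) \<Longrightarrow> fDLG (negS N \<turnstile>\<^sub>- D) \<Longrightarrow> fDLG (XPure (XOminus D X) \<turnstile>\<^sub>+ XPure (XFm (POminus N P)))"
| ton_under: "fDLG (X \<turnstile>\<^sub>+ posS P) \<Longrightarrow> fDLG (negS N \<turnstile>\<^sub>- D) \<Longrightarrow> fDLG (DPure (DFm (NUnder P N)) \<turnstile>\<^sub>- DPure (DUnder X D))"
| ton_over: "fDLG (X \<turnstile>\<^sub>+ posS P) \<Longrightarrow> fDLG (negS N \<turnstile>\<^sub>- D) \<Longrightarrow> fDLG (DPure (DFm (NOver N P)) \<turnstile>\<^sub>- DPure (DOver D X))"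
| ton_down: "fDLG (DPure (DFm N) \<turnstile>\<^sub>- DPure D) \<Longrightarrow> fDLG (XShift (SXFm (Down N)) \<turnstile>\<^sub>+ XShift (SXDown D))"
| ton_up: "fDLG (XPure X \<turnstile>\<^sub>+ XPure (XFm P)) \<Longrightarrow> fDLG (DShift (SDUp X) \<turnstile>\<^sub>- DShift (SDFm (Up P)))"
| dp_neu_tensor_1: "fDLG (Y \<turnstile>\<^sub>0 DPure (DUnder X D)) \<Longrightarrow> fDLG (XPure (XTensor X Y) \<turnstile>\<^sub>0 D)"
| dp_neu_tensor_2: "fDLG (XPure (XTensor X Y) \<turnstile>\<^sub>0 D) \<Longrightarrow> fDLG (Y \<turnstile>\<^sub>0 DPure (DUnder X D))"
| dp_neu_tensor_3: "fDLG (XPure (XTensor X Y) \<turnstile>\<^sub>0 D) \<Longrightarrow> fDLG (X \<turnstile>\<^sub>0 DPure (DOver D Y))"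
| dp_neu_tensor_4: "fDLG (X \<turnstile>\<^sub>0 DPure (DOver D Y)) \<Longrightarrow> fDLG (XPure (XTensor X Y) \<turnstile>\<^sub>0 D)"
| dp_neu_oplus_1: "fDLG (XPure (XOslash X D) \<turnstile>\<^sub>0 G) \<Longrightarrow> fDLG (X \<turnstile>\<^sub>0 DPure (DOplus G D))"
| dp_neu_oplus_2: "fDLG (X \<turnstile>\<^sub>0 DPure (DOplus G D)) \<Longrightarrow> fDLG (XPure (XOslash X D) \<turnstile>\<^sub>0 G)"
| dp_neu_oplus_3: "fDLG (X \<turnstile>\<^sub>0 DPure (DOplus G D)) \<Longrightarrow> fDLG (XPure (XOminus G X) \<turnstile>\<^sub>0 D)"
| dp_neu_oplus_4: "fDLG (XPure (XOminus G X) \<turnstile>\<^sub>0 D) \<Longrightarrow> fDLG (X \<turnstile>\<^sub>0 DPure (DOplus G D))"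
| dp_tensor_1: "fDLG (Y \<turnstile>\<^sub>+ XShift (SXUnderR X Z)) \<Longrightarrow> fDLG (XPure (XTensor X Y) \<turnstile>\<^sub>+ Z)"
| dp_tensor_2: "fDLG (XPure (XTensor X Y) \<turnstile>\<^sub>+ Z) \<Longrightarrow> fDLG (Y \<turnstile>\<^sub>+ XShift (SXUnderR X Z))"
| dp_tensor_3: "fDLG (XPure (XTensor X Y) \<turnstile>\<^sub>+ Z) \<Longrightarrow> fDLG (X \<turnstile>\<^sub>+ XShift (SXOverL Z Y))"
| dp_tensor_4: "fDLG (X \<turnstile>\<^sub>+ XShift (SXOverL Z Y)) \<Longrightarrow> fDLG (XPure (XTensor X Y) \<turnstile>\<^sub>+ Z)"
| dp_oplus_1: "fDLG (DShift (SDOslashL S D) \<turnstile>\<^sub>- G) \<Longrightarrow> fDLG (S \<turnstile>\<^sub>- DPure (DOplus G D))"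
| dp_oplus_2: "fDLG (S \<turnstile>\<^sub>- DPure (DOplus G D)) \<Longrightarrow> fDLG (DShift (SDOslashL S D) \<turnstile>\<^sub>- G)"
| dp_oplus_3: "fDLG (S \<turnstile>\<^sub>- DPure (DOplus G D)) \<Longrightarrow> fDLG (DShift (SDOminusR G S) \<turnstile>\<^sub>- D)"
| dp_oplus_4: "fDLG (DShift (SDOminusR G S) \<turnstile>\<^sub>- D) \<Longrightarrow> fDLG (S \<turnstile>\<^sub>- DPure (DOplus G D))"
| dp_ominus_1: "fDLG (XPure (XOminus G X) \<turnstile>\<^sub>+ Y) \<Longrightarrow> fDLG (X \<turnstile>\<^sub>+ XShift (SXOplusR G Y))"
| dp_ominus_2: "fDLG (X \<turnstile>\<^sub>+ XShift (SXOplusR G Y)) \<Longrightarrow> fDLG (XPure (XOminus G X) \<turnstile>\<^sub>+ Y)"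
| dp_ominus_3: "fDLG (X \<turnstile>\<^sub>+ XShift (SXOplusR G Y)) \<Longrightarrow> fDLG (DShift (SDOslashR X Y) \<turnstile>\<^sub>- G)"
| dp_ominus_4: "fDLG (DShift (SDOslashR X Y) \<turnstile>\<^sub>- G) \<Longrightarrow> fDLG (X \<turnstile>\<^sub>+ XShift (SXOplusR G Y))"
| dp_oslash_1: "fDLG (XPure (XOslash X D) \<turnstile>\<^sub>+ Y) \<Longrightarrow> fDLG (X \<turnstile>\<^sub>+ XShift (SXOplusL Y D))"
| dp_oslash_2: "fDLG (X \<turnstile>\<^sub>+ XShift (SXOplusL Y D)) \<Longrightarrow> fDLG (XPure (XOslash X D) \<turnstile>\<^sub>+ Y)"
| dp_oslash_3: "fDLG (X \<turnstile>\<^sub>+ XShift (SXOplusL Y D)) \<Longrightarrow> fDLG (DShift (SDOminusL Y X) \<turnstile>\<^sub>- D)"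
| dp_oslash_4: "fDLG (DShift (SDOminusL Y X) \<turnstile>\<^sub>- D) \<Longrightarrow> fDLG (X \<turnstile>\<^sub>+ XShift (SXOplusL Y D))"
| dp_under_1: "fDLG (G \<turnstile>\<^sub>- DPure (DUnder X D)) \<Longrightarrow> fDLG (DShift (SDTensorR X G) \<turnstile>\<^sub>- D)"
| dp_under_2: "fDLG (DShift (SDTensorR X G) \<turnstile>\<^sub>- D) \<Longrightarrow> fDLG (G \<turnstile>\<^sub>- DPure (DUnder X D))"
| dp_under_3: "fDLG (DShift (SDTensorR X G) \<turnstile>\<^sub>- D) \<Longrightarrow> fDLG (X \<turnstile>\<^sub>+ XShift (SXOverR D G))"
| dp_under_4: "fDLG (X \<turnstile>\<^sub>+ XShift (SXOverR D G)) \<Longrightarrow> fDLG (DShift (SDTensorR X G) \<turnstile>\<^sub>- D)"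
| dp_over_1: "fDLG (Y \<turnstile>\<^sub>+ XShift (SXUnderL G D)) \<Longrightarrow> fDLG (DShift (SDTensorL G Y) \<turnstile>\<^sub>- D)"
| dp_over_2: "fDLG (DShift (SDTensorL G Y) \<turnstile>\<^sub>- D) \<Longrightarrow> fDLG (Y \<turnstile>\<^sub>+ XShift (SXUnderL G D))"
| dp_over_3: "fDLG (DShift (SDTensorL G Y) \<turnstile>\<^sub>- D) \<Longrightarrow> fDLG (G \<turnstile>\<^sub>- DPure (DOver D Y))"
| dp_over_4: "fDLG (G \<turnstile>\<^sub>- DPure (DOver D Y)) \<Longrightarrow> fDLG (DShift (SDTensorL G Y) \<turnstile>\<^sub>- D)"
| dp_ddown_1: "fDLG (DShift (SDUp X) \<turnstile>\<^sub>- DShift D) \<Longrightarrow> fDLG (XPure X \<turnstile>\<^sub>+ XPure (XDDown D))"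
| dp_ddown_2: "fDLG (XPure X \<turnstile>\<^sub>+ XPure (XDDown D)) \<Longrightarrow> fDLG (DShift (SDUp X) \<turnstile>\<^sub>- DShift D)"
| dp_shift_1: "fDLG (DShift (SDUp X) \<turnstile>\<^sub>- DPure D) \<Longrightarrow> fDLG (XPure X \<turnstile>\<^sub>+ XShift (SXDown D))"
| dp_shift_2: "fDLG (XPure X \<turnstile>\<^sub>+ XShift (SXDown D)) \<Longrightarrow> fDLG (DShift (SDUp X) \<turnstile>\<^sub>- DPure D)"
| dp_uup_1: "fDLG (XShift X \<turnstile>\<^sub>+ XShift (SXDown D)) \<Longrightarrow> fDLG (DPure (DUUp X) \<turnstile>\<^sub>- DPure D)"
| dp_uup_2: "fDLG (DPure (DUUp X) \<turnstile>\<^sub>- DPure D) \<Longrightarrow> fDLG (XShift X \<turnstile>\<^sub>+ XShift (SXDown D))"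
| str_down_1: "fDLG (X \<turnstile>\<^sub>0 DPure D) \<Longrightarrow> fDLG (X \<turnstile>\<^sub>+ XShift (SXDown D))"
| str_down_2: "fDLG (X \<turnstile>\<^sub>+ XShift (SXDown D)) \<Longrightarrow> fDLG (X \<turnstile>\<^sub>0 DPure D)"
| str_up_1: "fDLG (XPure X \<turnstile>\<^sub>0 D) \<Longrightarrow> fDLG (DShift (SDUp X) \<turnstile>\<^sub>- D)"
| str_up_2: "fDLG (DShift (SDUp X) \<turnstile>\<^sub>- D) \<Longrightarrow> fDLG (XPure X \<turnstile>\<^sub>0 D)"


section \<open>Normal sequents\<close>

text \<open>
  \<open>fplus A\<close> is $A^+$ and \<open>fminus A\<close> is $A^-$. The clauses $A^-={\uparrow}(A^+)$ for positive \<open>A\<close> and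
  $A^+={\downarrow}(A^-)$ for negative \<open>A\<close> are spelled out connective by connective, which makes
  explicit that the shifted formula is pure; cf. the two lemmas below.
\<close>

fun fplus :: "fm \<Rightarrow> gpos" and fminus :: "fm \<Rightarrow> gneg" where
  "fplus (FPAtom p) = PPure (PAtom p)"
| "fplus (FTensor A B) = PPure (PTensor (fplus A) (fplus B))"
| "fplus (FOslash A B) = PPure (POslash (fplus A) (fminus B))"
| "fplus (FOminus A B) = PPure (POminus (fminus A) (fplus B))"
| "fplus (FNAtom n) = PShift (Down (NAtom n))"
| "fplus (FOplus A B) = PShift (Down (NOplus (fminus A) (fminus B)))"
| "fplus (FUnder A B) = PShift (Down (NUnder (fplus A) (fminus B)))"
| "fplus (FOver A B) = PShift (Down (NOver (fminus A) (fplus B)))"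
| "fminus (FNAtom n) = NPure (NAtom n)"
| "fminus (FOplus A B) = NPure (NOplus (fminus A) (fminus B))"
| "fminus (FUnder A B) = NPure (NUnder (fplus A) (fminus B))"
| "fminus (FOver A B) = NPure (NOver (fminus A) (fplus B))"
| "fminus (FPAtom p) = NShift (Up (PAtom p))"
| "fminus (FTensor A B) = NShift (Up (PTensor (fplus A) (fplus B)))"
| "fminus (FOslash A B) = NShift (Up (POslash (fplus A) (fminus B)))"
| "fminus (FOminus A B) = NShift (Up (POminus (fminus A) (fplus B)))"

lemma fminus_positive:
  "positive A \<Longrightarrow> \<exists>P. fplus A = PPure P \<and> fminus A = NShift (Up P)"
  by (cases A) simp_all

lemma fplus_negative:
  "negative A \<Longrightarrow> \<exists>N. fminus A = NPure N \<and> fplus A = PShift (Down N)"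
  by (cases A) simp_all

primrec iplus :: "istr \<Rightarrow> gposS" and ominus :: "ostr \<Rightarrow> gnegS" where
  "iplus (IFm A) = posS (fplus A)"
| "iplus (ITensor X Y) = XPure (XTensor (iplus X) (iplus Y))"
| "iplus (IOslash X D) = XPure (XOslash (iplus X) (ominus D))"
| "iplus (IOminus D X) = XPure (XOminus (ominus D) (iplus X))"
| "ominus (OFm A) = negS (fminus A)"
| "ominus (OOplus G D) = DPure (DOplus (ominus G) (ominus D))"
| "ominus (OUnder X D) = DPure (DUnder (iplus X) (ominus D))"
| "ominus (OOver D X) = DPure (DOver (ominus D) (iplus X))"

fun ceil_seq :: "fseq \<Rightarrow> fdseq" where
  "ceil_seq (RFocus X A) = (iplus X \<turnstile>\<^sub>+ posS (fplus A))"
| "ceil_seq (LFocus A D) = (negS (fminus A) \<turnstile>\<^sub>- ominus D)"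
| "ceil_seq (X \<turnstile> D) = (iplus X \<turnstile>\<^sub>0 ominus D)"

definition normal :: "fdseq \<Rightarrow> bool" where
  "normal S \<longleftrightarrow> (\<exists>S'. S = ceil_seq S')"


section \<open>The translation to f.LG\<close>

primrec floor_ppos :: "ppos \<Rightarrow> fm" and floor_pneg :: "pneg \<Rightarrow> fm"
  and floor_spos :: "spos \<Rightarrow> fm" and floor_sneg :: "sneg \<Rightarrow> fm"
  and floor_gpos :: "gpos \<Rightarrow> fm" and floor_gneg :: "gneg \<Rightarrow> fm" where
  "floor_ppos (PAtom p) = FPAtom p"
| "floor_ppos (PTensor P Q) = FTensor (floor_gpos P) (floor_gpos Q)"
| "floor_ppos (POslash P N) = FOslash (floor_gpos P) (floor_gneg N)"
| "floor_ppos (POminus N P) = FOminus (floor_gneg N) (floor_gpos P)"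
| "floor_pneg (NAtom n) = FNAtom n"
| "floor_pneg (NOplus N M) = FOplus (floor_gneg N) (floor_gneg M)"
| "floor_pneg (NUnder P N) = FUnder (floor_gpos P) (floor_gneg N)"
| "floor_pneg (NOver N P) = FOver (floor_gneg N) (floor_gpos P)"
| "floor_spos (Down N) = floor_pneg N"
| "floor_sneg (Up P) = floor_ppos P"
| "floor_gpos (PPure P) = floor_ppos P"
| "floor_gpos (PShift P) = floor_spos P"
| "floor_gneg (NPure N) = floor_pneg N"
| "floor_gneg (NShift N) = floor_sneg N"

text \<open>
  On structures and sequents the translation is partial, and left unspecified outside its domain:
  on structures with structural shifts or $\ell,r$-variants, and on positive (negative) sequents
  whose right (left) side is not a formula. Normal sequents lie in the domain, see
  \<open>floor_ceil_seq\<close>.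
\<close>

primrec (nonexhaustive) floor_pposS :: "pposS \<Rightarrow> istr" and floor_pnegS :: "pnegS \<Rightarrow> ostr"
  and floor_sposS :: "sposS \<Rightarrow> istr" and floor_snegS :: "snegS \<Rightarrow> ostr"
  and floor_gposS :: "gposS \<Rightarrow> istr" and floor_gnegS :: "gnegS \<Rightarrow> ostr" where
  "floor_pposS (XFm P) = IFm (floor_ppos P)"
| "floor_pposS (XTensor X Y) = ITensor (floor_gposS X) (floor_gposS Y)"
| "floor_pposS (XOslash X D) = IOslash (floor_gposS X) (floor_gnegS D)"
| "floor_pposS (XOminus D X) = IOminus (floor_gnegS D) (floor_gposS X)"
| "floor_pnegS (DFm N) = OFm (floor_pneg N)"
| "floor_pnegS (DOplus G D) = OOplus (floor_gnegS G) (floor_gnegS D)"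
| "floor_pnegS (DUnder X D) = OUnder (floor_gposS X) (floor_gnegS D)"
| "floor_pnegS (DOver D X) = OOver (floor_gnegS D) (floor_gposS X)"
| "floor_sposS (SXFm P) = IFm (floor_spos P)"
| "floor_snegS (SDFm N) = OFm (floor_sneg N)"
| "floor_gposS (XPure X) = floor_pposS X"
| "floor_gposS (XShift X) = floor_sposS X"
| "floor_gnegS (DPure D) = floor_pnegS D"
| "floor_gnegS (DShift D) = floor_snegS D"

fun floor_seq :: "fdseq \<Rightarrow> fseq" where
  "floor_seq (X \<turnstile>\<^sub>+ XPure (XFm P)) = RFocus (floor_gposS X) (floor_ppos P)"
| "floor_seq (X \<turnstile>\<^sub>+ XShift (SXFm P)) = RFocus (floor_gposS X) (floor_spos P)"
| "floor_seq (DPure (DFm N) \<turnstile>\<^sub>- D) = LFocus (floor_pneg N) (floor_gnegS D)"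
| "floor_seq (DShift (SDFm N) \<turnstile>\<^sub>- D) = LFocus (floor_sneg N) (floor_gnegS D)"
| "floor_seq (X \<turnstile>\<^sub>0 D) = (floor_gposS X \<turnstile> floor_gnegS D)"

lemma floor_fm: "floor_gpos (fplus A) = A" "floor_gneg (fminus A) = A"
  by (induction A) simp_all

lemma floor_posS [simp]: "floor_gposS (posS P) = IFm (floor_gpos P)"
  by (cases P) simp_all

lemma floor_negS [simp]: "floor_gnegS (negS N) = OFm (floor_gneg N)"
  by (cases N) simp_all

lemma floor_seq_posS [simp]: "floor_seq (X \<turnstile>\<^sub>+ posS P) = RFocus (floor_gposS X) (floor_gpos P)"
  by (cases P) simp_all

lemma floor_seq_negS [simp]: "floor_seq (negS N \<turnstile>\<^sub>- D) = LFocus (floor_gneg N) (floor_gnegS D)"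
  by (cases N) simp_all

lemma floor_str: "floor_gposS (iplus X) = X" "floor_gnegS (ominus D) = D"
  by (induction X and D) (simp_all add: floor_fm)

lemma floor_ceil_seq: "floor_seq (ceil_seq S) = S"
  by (cases S) (simp_all add: floor_fm floor_str)

end

theory Submission
  imports Defs
begin

text \<open>
  The calculus fD.LG, cuts included, is sound for a model built from derivability in f.LG.
  A positive object denotes sets of input structures and a negative object sets of output
  structures, shifts being read as orthogonals with respect to derivability of neutral sequents.
  Every formula has two denotations: a focused one, built by the tonicity rules only, and a larger
  active one, which also contains the formula itself. Positive objects left of a turnstile and
  negative objects right of it are read actively, all others focused, and a positive or negative
  sequent states an inclusion of an active denotation in a focused one. Since a formula's focused
  denotation is contained in its active one, cut is sound by transitivity, while the translation
  and focusing rules of f.LG are what makes the added formula harmless. Finally every input or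
  output structure lies in the active denotation of its own normal translation, and focused
  denotations contain only derivable right- or left-focused sequents.
\<close>

definition iperp :: "istr set \<Rightarrow> ostr set" where
  "iperp U = {D. \<forall>X\<in>U. fLG (X \<turnstile> D)}"

definition operp :: "ostr set \<Rightarrow> istr set" where
  "operp V = {X. \<forall>D\<in>V. fLG (X \<turnstile> D)}"

text \<open>The formula inserted in the shift clauses makes the orthogonal range over the active
  denotation of the pure formula, so members can be tested against the formula itself.\<close>

primrec foc_ppos :: "ppos \<Rightarrow> istr set" and foc_pneg :: "pneg \<Rightarrow> ostr set"
  and foc_spos :: "spos \<Rightarrow> istr set" and foc_sneg :: "sneg \<Rightarrow> ostr set"
  and foc_gpos :: "gpos \<Rightarrow> istr set" and foc_gneg :: "gneg \<Rightarrow> ostr set" where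
  "foc_ppos (PAtom p) = {IFm (FPAtom p)}"
| "foc_ppos (PTensor P Q) = {ITensor X Y | X Y. X \<in> foc_gpos P \<and> Y \<in> foc_gpos Q}"
| "foc_ppos (POslash P N) = {IOslash X D | X D. X \<in> foc_gpos P \<and> D \<in> foc_gneg N}"
| "foc_ppos (POminus N P) = {IOminus D X | D X. D \<in> foc_gneg N \<and> X \<in> foc_gpos P}"
| "foc_pneg (NAtom n) = {OFm (FNAtom n)}"
| "foc_pneg (NOplus N M) = {OOplus G D | G D. G \<in> foc_gneg N \<and> D \<in> foc_gneg M}"
| "foc_pneg (NUnder P N) = {OUnder X D | X D. X \<in> foc_gpos P \<and> D \<in> foc_gneg N}"
| "foc_pneg (NOver N P) = {OOver D X | D X. D \<in> foc_gneg N \<and> X \<in> foc_gpos P}"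
| "foc_spos (Down N) = operp (insert (OFm (floor_pneg N)) (foc_pneg N))"
| "foc_sneg (Up P) = iperp (insert (IFm (floor_ppos P)) (foc_ppos P))"
| "foc_gpos (PPure P) = foc_ppos P"
| "foc_gpos (PShift P) = foc_spos P"
| "foc_gneg (NPure N) = foc_pneg N"
| "foc_gneg (NShift N) = foc_sneg N"

text \<open>
  The denotations of structures are left unspecified where no rule constrains them: the
  $\ell,r$-variants and structural shifts are only displayed in focused position, the other
  structural connectives only in active position.
\<close>

primrec (nonexhaustive) act_pposS :: "pposS \<Rightarrow> istr set" and act_pnegS :: "pnegS \<Rightarrow> ostr set"
  and act_sposS :: "sposS \<Rightarrow> istr set" and act_snegS :: "snegS \<Rightarrow> ostr set"
  and act_gposS :: "gposS \<Rightarrow> istr set" and act_gnegS :: "gnegS \<Rightarrow> ostr set" where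
  "act_pposS (XFm P) = insert (IFm (floor_ppos P)) (foc_ppos P)"
| "act_pposS (XTensor X Y) = {ITensor x y | x y. x \<in> act_gposS X \<and> y \<in> act_gposS Y}"
| "act_pposS (XOslash X D) = {IOslash x d | x d. x \<in> act_gposS X \<and> d \<in> act_gnegS D}"
| "act_pposS (XOminus D X) = {IOminus d x | d x. d \<in> act_gnegS D \<and> x \<in> act_gposS X}"
| "act_pnegS (DFm N) = insert (OFm (floor_pneg N)) (foc_pneg N)"
| "act_pnegS (DOplus G D) = {OOplus g d | g d. g \<in> act_gnegS G \<and> d \<in> act_gnegS D}"
| "act_pnegS (DUnder X D) = {OUnder x d | x d. x \<in> act_gposS X \<and> d \<in> act_gnegS D}"
| "act_pnegS (DOver D X) = {OOver d x | d x. d \<in> act_gnegS D \<and> x \<in> act_gposS X}"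
| "act_sposS (SXFm P) = insert (IFm (floor_spos P)) (foc_spos P)"
| "act_snegS (SDFm N) = insert (OFm (floor_sneg N)) (foc_sneg N)"
| "act_gposS (XPure X) = act_pposS X"
| "act_gposS (XShift X) = act_sposS X"
| "act_gnegS (DPure D) = act_pnegS D"
| "act_gnegS (DShift D) = act_snegS D"

text \<open>Each variant is the residual of a pure connective, so all sequents joined by a focused
  display postulate unfold to one condition with reordered quantifiers.\<close>

primrec (nonexhaustive) foc_pposS :: "pposS \<Rightarrow> istr set" and foc_pnegS :: "pnegS \<Rightarrow> ostr set"
  and foc_sposS :: "sposS \<Rightarrow> istr set" and foc_snegS :: "snegS \<Rightarrow> ostr set"
  and foc_gposS :: "gposS \<Rightarrow> istr set" and foc_gnegS :: "gnegS \<Rightarrow> ostr set" where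
  "foc_pposS (XFm P) = foc_ppos P"
| "foc_pposS (XDDown D) = operp (act_snegS D)"
| "foc_pnegS (DFm N) = foc_pneg N"
| "foc_pnegS (DUUp X) = iperp (act_sposS X)"
| "foc_sposS (SXFm P) = foc_spos P"
| "foc_sposS (SXDown D) = operp (act_pnegS D)"
| "foc_sposS (SXOplusL Y D) = {x. \<forall>d\<in>act_gnegS D. IOslash x d \<in> foc_gposS Y}"
| "foc_sposS (SXOplusR G Y) = {x. \<forall>g\<in>act_gnegS G. IOminus g x \<in> foc_gposS Y}"
| "foc_sposS (SXUnderL G D) = {y. \<forall>d\<in>act_gnegS D. OOver d y \<in> foc_gnegS G}"
| "foc_sposS (SXUnderR X Z) = {y. \<forall>x\<in>act_gposS X. ITensor x y \<in> foc_gposS Z}"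
| "foc_sposS (SXOverL Z Y) = {x. \<forall>y\<in>act_gposS Y. ITensor x y \<in> foc_gposS Z}"
| "foc_sposS (SXOverR D G) = {x. \<forall>d\<in>act_gnegS D. OUnder x d \<in> foc_gnegS G}"
| "foc_snegS (SDFm N) = foc_sneg N"
| "foc_snegS (SDUp X) = iperp (act_pposS X)"
| "foc_snegS (SDTensorL G Y) = {d. \<forall>y\<in>act_gposS Y. OOver d y \<in> foc_gnegS G}"
| "foc_snegS (SDTensorR X G) = {d. \<forall>x\<in>act_gposS X. OUnder x d \<in> foc_gnegS G}"
| "foc_snegS (SDOslashL S D) = {g. \<forall>d\<in>act_gnegS D. OOplus g d \<in> foc_gnegS S}"
| "foc_snegS (SDOslashR X Y) = {g. \<forall>x\<in>act_gposS X. IOminus g x \<in> foc_gposS Y}"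
| "foc_snegS (SDOminusL Y X) = {d. \<forall>x\<in>act_gposS X. IOslash x d \<in> foc_gposS Y}"
| "foc_snegS (SDOminusR G S) = {d. \<forall>g\<in>act_gnegS G. OOplus g d \<in> foc_gnegS S}"
| "foc_gposS (XPure X) = foc_pposS X"
| "foc_gposS (XShift X) = foc_sposS X"
| "foc_gnegS (DPure D) = foc_pnegS D"
| "foc_gnegS (DShift D) = foc_snegS D"

text \<open>Negative inclusions run backwards because a negative object denotes output structures,
  its possible right-hand sides.\<close>

fun valid :: "fdseq \<Rightarrow> bool" where
  "valid (X \<turnstile>\<^sub>+ Y) \<longleftrightarrow> act_gposS X \<subseteq> foc_gposS Y"
| "valid (G \<turnstile>\<^sub>- D) \<longleftrightarrow> act_gnegS D \<subseteq> foc_gnegS G"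
| "valid (X \<turnstile>\<^sub>0 D) \<longleftrightarrow> (\<forall>x\<in>act_gposS X. \<forall>d\<in>act_gnegS D. fLG (x \<turnstile> d))"

lemma foc_posS [simp]: "foc_gposS (posS P) = foc_gpos P"
  by (cases P) simp_all

lemma foc_negS [simp]: "foc_gnegS (negS N) = foc_gneg N"
  by (cases N) simp_all

lemma act_posS [simp]: "act_gposS (posS P) = insert (IFm (floor_gpos P)) (foc_gpos P)"
  by (cases P) simp_all

lemma act_negS [simp]: "act_gnegS (negS N) = insert (OFm (floor_gneg N)) (foc_gneg N)"
  by (cases N) simp_all

lemma positive_floor_ppos: "positive (floor_ppos P)"
  by (cases P) simp_all

lemma negative_floor_pneg: "negative (floor_pneg N)"
  by (cases N) simp_all

text \<open>Pure cases follow by tonicity. For a shift, testing the orthogonal on the inserted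
  formula gives a neutral sequent, whose formula is then focused by its polarity.\<close>

lemma foc_derivable:
  "X \<in> foc_ppos P \<Longrightarrow> fLG (RFocus X (floor_ppos P))"
  "D \<in> foc_pneg N \<Longrightarrow> fLG (LFocus (floor_pneg N) D)"
  "X \<in> foc_spos P' \<Longrightarrow> fLG (RFocus X (floor_spos P'))"
  "D \<in> foc_sneg N' \<Longrightarrow> fLG (LFocus (floor_sneg N') D)"
  "X \<in> foc_gpos P'' \<Longrightarrow> fLG (RFocus X (floor_gpos P''))"
  "D \<in> foc_gneg N'' \<Longrightarrow> fLG (LFocus (floor_gneg N'') D)"
  by (induction P and N and P' and N' and P'' and N''
      arbitrary: X D and X D and X D and X D and X D and X D)
    (auto simp: iperp_def operp_def positive_floor_ppos negative_floor_pneg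
      intro: f_ax_pos f_ax_neg f_ton_tensor f_ton_oplus f_ton_oslash f_ton_ominus f_ton_under f_ton_over
        f_foc_left f_foc_right)

lemma neutral_of_foc_ppos: "X \<in> foc_ppos P \<Longrightarrow> fLG (X \<turnstile> OFm (floor_ppos P))"
  by (simp add: f_defoc_right foc_derivable positive_floor_ppos)

lemma neutral_of_foc_pneg: "D \<in> foc_pneg N \<Longrightarrow> fLG (IFm (floor_pneg N) \<turnstile> D)"
  by (simp add: f_defoc_left foc_derivable negative_floor_pneg)

lemma soundness: "fDLG S \<Longrightarrow> valid S"
proof (induction rule: fDLG.induct)
  \<comment> \<open>Only the inserted compound formula needs the f.LG translation rule; focused
    members are built from members already covered by the premise.\<close>
  case tr_tensor then show ?case by (auto simp: iperp_def operp_def subset_iff intro: f_tr_tensor)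
next
  case tr_oslash then show ?case by (auto simp: iperp_def operp_def subset_iff intro: f_tr_oslash)
next
  case tr_ominus then show ?case by (auto simp: iperp_def operp_def subset_iff intro: f_tr_ominus)
next
  case tr_oplus then show ?case by (auto simp: iperp_def operp_def subset_iff intro: f_tr_oplus)
next
  case tr_under then show ?case by (auto simp: iperp_def operp_def subset_iff intro: f_tr_under)
next
  case tr_over then show ?case by (auto simp: iperp_def operp_def subset_iff intro: f_tr_over)
next
  \<comment> \<open>The inserted formula must lie in the orthogonal too; defocusing puts it
    there.\<close>
  case ton_down then show ?case by (auto simp: iperp_def operp_def subset_iff intro: neutral_of_foc_pneg)
next
  case ton_up then show ?case by (auto simp: iperp_def operp_def subset_iff intro: neutral_of_foc_ppos)
next
  case dp_neu_tensor_1 then show ?case by (auto simp: iperp_def operp_def subset_iff intro: f_dp_tensor_1)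
next
  case dp_neu_tensor_2 then show ?case by (auto simp: iperp_def operp_def subset_iff intro: f_dp_tensor_2)
next
  case dp_neu_tensor_3 then show ?case by (auto simp: iperp_def operp_def subset_iff intro: f_dp_tensor_3)
next
  case dp_neu_tensor_4 then show ?case by (auto simp: iperp_def operp_def subset_iff intro: f_dp_tensor_4)
next
  case dp_neu_oplus_1 then show ?case by (auto simp: iperp_def operp_def subset_iff intro: f_dp_oplus_1)
next
  case dp_neu_oplus_2 then show ?case by (auto simp: iperp_def operp_def subset_iff intro: f_dp_oplus_2)
next
  case dp_neu_oplus_3 then show ?case by (auto simp: iperp_def operp_def subset_iff intro: f_dp_oplus_3)
next
  case dp_neu_oplus_4 then show ?case by (auto simp: iperp_def operp_def subset_iff intro: f_dp_oplus_4)
\<comment> \<open>Cuts use that focused denotations lie in active ones. Both sides of each shift or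
  structural rule unfold to the same condition.\<close>
qed (auto simp: iperp_def operp_def subset_iff)

text \<open>At the leaves, the formula inserted in the active denotation is \<open>A\<close> itself,
  since \<open>floor_fm\<close> undoes \<open>fplus\<close> and \<open>fminus\<close>.\<close>

lemma act_self: "X \<in> act_gposS (iplus X)" "D \<in> act_gnegS (ominus D)"
  by (induction X and D) (auto simp: floor_fm)

theorem theorem52:
  fixes S :: fdseq
  assumes "normal S" and "fDLG S"
  shows "fLG (floor_seq S)"
proof -
  obtain S' where S: "S = ceil_seq S'"
    using assms(1) by (auto simp: normal_def)
  have "valid (ceil_seq S')"
    using soundness[OF assms(2)] S by simp
  then have "fLG S'"
  proof (cases S')
    case (Neutral X D)
    then show ?thesis
      using \<open>valid (ceil_seq S')\<close> act_self by simp
  next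
    case (RFocus X A)
    then have "X \<in> foc_gpos (fplus A)"
      using \<open>valid (ceil_seq S')\<close> act_self(1) by auto
    then show ?thesis
      using foc_derivable(5) RFocus by (fastforce simp: floor_fm)
  next
    case (LFocus A D)
    then have "D \<in> foc_gneg (fminus A)"
      using \<open>valid (ceil_seq S')\<close> act_self(2) by auto
    then show ?thesis
      using foc_derivable(6) LFocus by (fastforce simp: floor_fm)
  qed
  then show ?thesis
    by (simp add: S floor_ceil_seq)
qed

end
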